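(* Let $m\ge2$, let $z^+\in\mathbb{R}^m$ be the utopian point, $r\in\mathbb{R}^m$ the reference point, and $\rho$ a nonnegative weight density on the simplex $\Delta^{m-1}$. For every finite nonempty set $A\subset\mathbb{R}^m$, the exact integral $R_2$ improvement equals the $\rho$-weighted volume of the scalarization-space shadow: $$I_{R_2}(A;r)=\int_{\mathcal{H}(A;r)}\rho(\lambda)\,d\sigma(\lambda)\,dt,\qquad \mathcal{H}(A;r)=\{(\lambda,t):\lambda\in\Delta^{m-1},\ h_A(\lambda)\le t\le h_r(\lambda)\}.$$
   Context: $\Delta^{m-1}=\{\lambda\in\mathbb{R}_+^m:\sum_i\lambda_i=1\}$, $\sigma$ is the surface (Lebesgue) measure on $\Delta^{m-1}$, and $\rho:\Delta^{m-1}\to[0,\infty)$ is an integrable weight density. The weighted Tchebycheff scalarization is $g_\lambda(y;z^+)=\max_i\lambda_i(y_i-z_i^+)$; the scalarization envelope of a finite nonempty set $A$ is $h_A(\lambda)=\min_{a\in A}g_\lambda(a;z^+)$, and $h_r(\lambda)=g_\lambda(r;z^+)$. The exact integral $R_2$ improvement is $I_{R_2}(A;r)=\int_{\Delta^{m-1}}(h_r(\lambda)-h_A(\lambda))_+\,\rho(\lambda)\,d\sigma(\lambda)$ with $(u)_+=\max\{u,0\}$. *)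

theory Defs
  imports "HOL-Analysis.Analysis"
begin

definition std_simplex :: "(real ^ 'm) set" where
  "std_simplex = {l. (\<forall>i. 0 \<le> l $ i) \<and> (\<Sum>i\<in>UNIV. l $ i) = 1}"

text \<open>
  The hyperplane of vectors with coordinate sum 1 is the graph of an affine function with gradient
  \<open>(-1, ..., -1)\<close> over the coordinates other than \<open>k\<close>.
  Hence its surface element is
  \<open>sqrt (1 + (m - 1)) = sqrt m\<close> times the \<open>(m - 1)\<close>-dimensional Lebesgue measure of those
  coordinates. The completion makes all Lebesgue (not only Borel) measurable weights admissible.
\<close>

definition simplex_chart :: "'m \<Rightarrow> ('m \<Rightarrow> real) \<Rightarrow> real ^ 'm" where
  "simplex_chart k x = (\<chi> i. if i = k then 1 - (\<Sum>j\<in>- {k}. x j) else x i)"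

definition chart_measure :: "'m \<Rightarrow> (real ^ 'm) measure" where
  "chart_measure k =
     scale_measure (ennreal (sqrt (real CARD('m))))
       (distr (Pi\<^sub>M (- {k}) (\<lambda>_. lborel)) borel (simplex_chart k))"

text \<open>The eliminated coordinate is irrelevant, see \<open>chart_measure_eq\<close> below.\<close>

definition simplex_measure :: "(real ^ 'm) measure" where
  "simplex_measure = completion (restrict_space (chart_measure (SOME k. True)) std_simplex)"

lemma simplex_chart_measurable [measurable]:
  fixes k :: "'m::finite"
  shows "simplex_chart k \<in> borel_measurable (Pi\<^sub>M (- {k}) (\<lambda>_. lborel))"
proof (subst borel_measurable_euclidean_space, safe)
  fix b :: "real ^ 'm" assume "b \<in> Basis"
  then obtain i where b: "b = axis i 1" by (auto simp: Basis_vec_def)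
  show "(\<lambda>x. simplex_chart k x \<bullet> b) \<in> borel_measurable (Pi\<^sub>M (- {k}) (\<lambda>_. lborel))"
  proof (cases "i = k")
    case True
    have "(\<lambda>x. simplex_chart k x \<bullet> b) = (\<lambda>x. 1 - (\<Sum>j\<in>- {k}. x j))"
      by (auto simp: b True inner_axis simplex_chart_def)
    then show ?thesis by simp
  next
    case False
    have "(\<lambda>x. simplex_chart k x \<bullet> b) = (\<lambda>x. x i)"
      by (auto simp: b False inner_axis simplex_chart_def)
    then show ?thesis using False by simp
  qed
qed

lemma space_simplex_measure: "space simplex_measure = std_simplex"
  by (simp add: simplex_measure_def chart_measure_def space_restrict_space space_scale_measure)

lemma chart_measure_eq:
  fixes k l :: "'m::finite"
  shows "chart_measure k = chart_measure l"
proof (cases "k = l")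
  case False
  interpret product_sigma_finite "\<lambda>_::'m. lborel :: real measure" ..
  define I where "I = - {k, l}"
  have I: "- {k} = insert l I" "- {l} = insert k I" "k \<notin> I" "l \<notin> I" "finite I"
    using False by (auto simp: I_def)
  have chart: "simplex_chart k (x(l := 1 - (\<Sum>j\<in>I. x j) + (-1) * y)) = simplex_chart l (x(k := y))"
    for x y
  proof -
    have s: "(\<Sum>j\<in>I. if j = a then c else x j) = (\<Sum>j\<in>I. x j)" if "a \<notin> I" for a c
      using that by (intro sum.cong) auto
    show ?thesis
      using False I(3-5) by (auto simp: simplex_chart_def vec_eq_iff I(1,2) s fun_upd_def)
  qed
  have meas: "(\<lambda>x. indicator B (simplex_chart i x) :: ennreal) \<in> borel_measurable (Pi\<^sub>M (- {i}) (\<lambda>_. lborel))"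
    if "B \<in> sets borel" for B i
    using that by measurable
  have "distr (Pi\<^sub>M (- {k}) (\<lambda>_. lborel)) borel (simplex_chart k) =
        distr (Pi\<^sub>M (- {l}) (\<lambda>_. lborel)) borel (simplex_chart l)" (is "?M k = ?M l")
  proof (rule measure_eqI)
    fix B assume "B \<in> sets (?M k)"
    then have B [measurable]: "B \<in> sets borel" by simp
    have em: "emeasure (?M i) B = (\<integral>\<^sup>+x. indicator B (simplex_chart i x) \<partial>Pi\<^sub>M (- {i}) (\<lambda>_. lborel))" for i
      by (subst nn_integral_indicator [symmetric], simp, subst nn_integral_distr) simp_all
    have "(\<integral>\<^sup>+y. indicator B (simplex_chart k (x(l := y))) \<partial>lborel) =
          (\<integral>\<^sup>+y. indicator B (simplex_chart l (x(k := y))) \<partial>lborel)" (is "?L = ?R")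
      if x: "x \<in> space (Pi\<^sub>M I (\<lambda>_. lborel :: real measure))" for x
    proof -
      have upd: "(\<lambda>y. x(l := y)) \<in> measurable lborel (Pi\<^sub>M (- {k}) (\<lambda>_. lborel :: real measure))"
        using measurable_component_update [OF x, of l] I by simp
      have "(\<lambda>y. indicator B (simplex_chart k (x(l := y))) :: ennreal) \<in> borel_measurable borel"
        using measurable_compose [OF upd meas [OF B]] by simp
      then have "?L = (\<integral>\<^sup>+y. indicator B (simplex_chart k (x(l := 1 - (\<Sum>j\<in>I. x j) + (-1) * y))) \<partial>lborel)"
        by (subst nn_integral_real_affine [where c = "-1" and t = "1 - (\<Sum>j\<in>I. x j)"]) auto
      then show ?thesis by (simp only: chart)
    qed
    then have eq: "(\<integral>\<^sup>+x. \<integral>\<^sup>+y. indicator B (simplex_chart k (x(l := y))) \<partial>lborel \<partial>Pi\<^sub>M I (\<lambda>_. lborel)) =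
        (\<integral>\<^sup>+x. \<integral>\<^sup>+y. indicator B (simplex_chart l (x(k := y))) \<partial>lborel \<partial>Pi\<^sub>M I (\<lambda>_. lborel))"
      by (rule nn_integral_cong)
    show "emeasure (?M k) B = emeasure (?M l) B"
      unfolding em unfolding I(1,2)
      by (subst (1 2) product_nn_integral_insert)
         (use I(3-5) meas [OF B, of k, unfolded I(1)] meas [OF B, of l, unfolded I(2)] eq in simp_all)
  qed simp
  then show ?thesis by (simp add: chart_measure_def)
qed simp

definition tcheby :: "real ^ 'm \<Rightarrow> real ^ 'm \<Rightarrow> real ^ 'm \<Rightarrow> real" where
  "tcheby z l y = Max (range (\<lambda>i. l $ i * (y $ i - z $ i)))"

definition envelope :: "real ^ 'm \<Rightarrow> (real ^ 'm) set \<Rightarrow> real ^ 'm \<Rightarrow> real" where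
  "envelope z A l = Min (tcheby z l ` A)"

definition R2_improvement ::
  "real ^ 'm \<Rightarrow> (real ^ 'm \<Rightarrow> real) \<Rightarrow> (real ^ 'm) set \<Rightarrow> real ^ 'm \<Rightarrow> real" where
  "R2_improvement z \<rho> A r =
     (\<integral>l. max (tcheby z l r - envelope z A l) 0 * \<rho> l \<partial>simplex_measure)"

definition shadow ::
  "real ^ 'm \<Rightarrow> (real ^ 'm) set \<Rightarrow> real ^ 'm \<Rightarrow> ((real ^ 'm) \<times> real) set" where
  "shadow z A r = {(l, t). l \<in> std_simplex \<and> envelope z A l \<le> t \<and> t \<le> tcheby z l r}"

end

theory Submission
  imports Defs
begin

text \<open>
  Over a fixed weight vector \<open>l\<close> the fibre of the shadow is the closed interval from
  \<open>envelope z A l\<close> to \<open>tcheby z l r\<close>, which is empty if the endpoints come in the wrong order.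
  Its length is thus exactly the positive part that \<open>R2_improvement\<close> integrates, and the theorem is
  Tonelli's theorem for \<open>\<rho>\<close> on the shadow (\<open>integral_between_graphs\<close>). This needs both endpoints
  to be measurable in \<open>l\<close>; they are, being finite maxima and minima of linear functions of \<open>l\<close>.

  Since \<open>\<rho>\<close> is nonnegative on the simplex, both Bochner integrals are the real values of one and
  the same extended nonnegative integral, so the comparison can be made entirely at that level.
\<close>

text \<open>
  Tonelli's theorem in the order that integrates \<open>t\<close> first only asks the inner measure, here
  \<open>lborel\<close>, to be \<open>\<sigma>\<close>-finite, hence \<open>M\<close> can be arbitrary.
\<close>

lemma integral_between_graphs:
  fixes f g w :: "'a \<Rightarrow> real"
  assumes [measurable]: "f \<in> borel_measurable M" "g \<in> borel_measurable M" "w \<in> borel_measurable M"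
    and w: "\<And>x. x \<in> space M \<Longrightarrow> 0 \<le> w x"
  shows "(LINT p:{(x, t). x \<in> space M \<and> f x \<le> t \<and> t \<le> g x}|M \<Otimes>\<^sub>M lborel. w (fst p)) =
    (\<integral>x. max (g x - f x) 0 * w x \<partial>M)"
proof -
  define S where "S = {(x, t). x \<in> space M \<and> f x \<le> t \<and> t \<le> g x}"
  have "S = {p \<in> space (M \<Otimes>\<^sub>M lborel). f (fst p) \<le> snd p \<and> snd p \<le> g (fst p)}"
    by (auto simp: S_def space_pair_measure)
  also have "\<dots> \<in> sets (M \<Otimes>\<^sub>M lborel)" by measurable
  finally have [measurable]: "S \<in> sets (M \<Otimes>\<^sub>M lborel)" .
  have fibre: "(\<integral>\<^sup>+t. ennreal (indicator S (x, t) * w x) \<partial>lborel) =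
      ennreal (max (g x - f x) 0 * w x)" if x: "x \<in> space M" for x
  proof -
    have "(\<integral>\<^sup>+t. ennreal (indicator S (x, t) * w x) \<partial>lborel) =
        (\<integral>\<^sup>+t. ennreal (w x) * indicator {f x..g x} t \<partial>lborel)"
      using x by (intro nn_integral_cong) (auto simp: S_def indicator_def)
    also have "\<dots> = ennreal (w x) * emeasure lborel {f x..g x}"
      by (simp add: nn_integral_cmult)
    also have "\<dots> = ennreal (max (g x - f x) 0 * w x)"
      using w [OF x] by (auto simp: emeasure_lborel_Icc_eq ennreal_mult' mult.commute max_def)
    finally show ?thesis .
  qed
  have "(LINT p:S|M \<Otimes>\<^sub>M lborel. w (fst p)) =
      enn2real (\<integral>\<^sup>+p. ennreal (indicator S p * w (fst p)) \<partial>(M \<Otimes>\<^sub>M lborel))"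
    unfolding set_lebesgue_integral_def real_scaleR_def
    by (intro integral_eq_nn_integral AE_I2) (auto simp: w space_pair_measure)
  also have "(\<integral>\<^sup>+p. ennreal (indicator S p * w (fst p)) \<partial>(M \<Otimes>\<^sub>M lborel)) =
      (\<integral>\<^sup>+x. \<integral>\<^sup>+t. ennreal (indicator S (x, t) * w x) \<partial>lborel \<partial>M)"
    by (subst lborel.nn_integral_fst [symmetric]) simp_all
  also have "\<dots> = (\<integral>\<^sup>+x. ennreal (max (g x - f x) 0 * w x) \<partial>M)"
    by (intro nn_integral_cong fibre)
  also have "enn2real \<dots> = (\<integral>x. max (g x - f x) 0 * w x \<partial>M)"
    by (intro integral_eq_nn_integral [symmetric] AE_I2) (auto simp: w)
  finally show ?thesis by (simp add: S_def)
qed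

lemma borel_measurable_tcheby: "(\<lambda>l. tcheby z l y) \<in> borel_measurable borel"
  unfolding tcheby_def by (intro borel_measurable_Max) auto

lemma borel_measurable_envelope:
  assumes "finite A"
  shows "envelope z A \<in> borel_measurable borel"
  unfolding envelope_def [abs_def]
  using assms by (intro borel_measurable_Min borel_measurable_tcheby)

lemma borel_measurable_simplex_measureI:
  assumes "f \<in> borel_measurable borel"
  shows "f \<in> borel_measurable simplex_measure"
  unfolding simplex_measure_def
  by (intro measurable_completion measurable_restrict_space1)
    (use assms in \<open>simp add: chart_measure_def measurable_def space_scale_measure\<close>)

theorem theorem5p2:
  fixes z r :: "real ^ 'm" and \<rho> :: "real ^ 'm \<Rightarrow> real" and A :: "(real ^ 'm) set"
  assumes "CARD('m) \<ge> 2"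
    and "\<And>l. l \<in> std_simplex \<Longrightarrow> 0 \<le> \<rho> l"
    and "integrable simplex_measure \<rho>"
    and "finite A" and "A \<noteq> {}"
  shows "R2_improvement z \<rho> A r =
    (LINT p:shadow z A r|simplex_measure \<Otimes>\<^sub>M lborel. \<rho> (fst p))"
  unfolding R2_improvement_def shadow_def space_simplex_measure [symmetric]
  by (rule integral_between_graphs [symmetric])
    (use assms in \<open>auto simp: space_simplex_measure
       intro!: borel_measurable_simplex_measureI borel_measurable_tcheby borel_measurable_envelope\<close>)

end
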